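(* For each positive integer $j$, the poset $P_j$ (defined in the context) has the minimum width and the minimum cardinality over all polyunsaturated posets with the same height as $P_j$. That is, every polyunsaturated poset $P$ whose height equals that of $P_j$ has width at least the width of $P_j$ and cardinality at least that of $P_j$.
   Context: Definition of the posets $P_j$ (inductive). $P_1$ is a chain $Q_1$ of three elements $u<s_1<r_1$, and $T_1=\{u\}$. For $j>1$, $P_j$ is the disjoint union of $P_{j-1}$ with a new chain $Q_j$ of $j+1$ elements, plus one new relation: let $r_j$ be the maximal element of $Q_j$, $s_j$ the next-greatest element of $Q_j$, and $T_j$ the set of the remaining $j-1$ elements of $Q_j$; add the cover relation $s_{j-1}<s_j$ and extend by transitivity. (Each $P_j$ is itself polyunsaturated in the sense below.) All posets are finite. The height (resp. width) of a poset is the maximum size of a chain (resp. antichain) in it. For a positive integer $k$, $d_k(P)$ is the maximum size of a union of $k$ antichains in $P$. For a partition $\mathcal C$ of a finite set, $m_k(\mathcal C)=\sum_{C\in\mathcal C}\min\{k,|C|\}$. A chain partition of $P$ (a partition $\mathcal C$ of $P$ into chains) is $k$-saturated if $d_k(P)=m_k(\mathcal C)$. A poset $P$ of height $c$ is polyunsaturated if there are no distinct, nonconsecutive positive integers $k,l<c$ for which $P$ has a chain partition that is simultaneously $k$-saturated and $l$-saturated. *)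

theory Defs
  imports Main "HOL-Library.Disjoint_Sets"
begin

text \<open>A finite poset is a finite reflexive order relation \<open>r\<close>; since \<open>r\<close> is reflexive,
  its set of elements is \<open>Field r\<close>. Chains are given by the library's \<open>Chains r\<close>.\<close>

definition finite_poset :: "'a rel \<Rightarrow> bool" where
  "finite_poset r \<longleftrightarrow> finite (Field r) \<and> Partial_order r"

definition Antichains :: "'a rel \<Rightarrow> 'a set set" where
  "Antichains r = {A. A \<subseteq> Field r \<and> (\<forall>x\<in>A. \<forall>y\<in>A. (x, y) \<in> r \<longrightarrow> x = y)}"

definition height :: "'a rel \<Rightarrow> nat" where
  "height r = Max (card ` Chains r)"

definition width :: "'a rel \<Rightarrow> nat" where
  "width r = Max (card ` Antichains r)"

definition max_antichain_union :: "nat \<Rightarrow> 'a rel \<Rightarrow> nat" where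
  "max_antichain_union k r =
     Max {card (\<Union>i<k. F i) | F :: nat \<Rightarrow> 'a set. \<forall>i<k. F i \<in> Antichains r}"

definition truncated_size :: "nat \<Rightarrow> 'a set set \<Rightarrow> nat" where
  "truncated_size k \<C> = (\<Sum>C\<in>\<C>. min k (card C))"

definition chain_partition :: "'a rel \<Rightarrow> 'a set set \<Rightarrow> bool" where
  "chain_partition r \<C> \<longleftrightarrow> partition_on (Field r) \<C> \<and> \<C> \<subseteq> Chains r"

definition saturated :: "nat \<Rightarrow> 'a rel \<Rightarrow> 'a set set \<Rightarrow> bool" where
  "saturated k r \<C> \<longleftrightarrow> max_antichain_union k r = truncated_size k \<C>"

definition polyunsaturated :: "'a rel \<Rightarrow> bool" where
  "polyunsaturated r \<longleftrightarrow> finite_poset r \<and>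
     \<not> (\<exists>k l. 0 < k \<and> k < height r \<and> 0 < l \<and> l < height r \<and>
           k \<noteq> l \<and> k \<noteq> Suc l \<and> l \<noteq> Suc k \<and>
           (\<exists>\<C>. chain_partition r \<C> \<and> saturated k r \<C> \<and> saturated l r \<C>))"

text \<open>The elements of the chain \<open>Q\<^sub>i\<close> are the pairs \<open>(i, a)\<close> with \<open>a < Q_size i\<close>, in increasing
  order of \<open>a\<close>. So \<open>r\<^sub>i = (i, Q_size i - 1)\<close>, \<open>s\<^sub>i = (i, Q_size i - 2)\<close>, and \<open>T\<^sub>i\<close> consists of the
  remaining, lower elements; in particular \<open>u = (1, 0)\<close>.\<close>

definition Q_size :: "nat \<Rightarrow> nat" where
  "Q_size i = (if i = 1 then 3 else i + 1)"

definition Q_chain :: "nat \<Rightarrow> (nat \<times> nat) rel" where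
  "Q_chain i = {((i, a), (i, b)) | a b. a \<le> b \<and> b < Q_size i}"

definition s_elem :: "nat \<Rightarrow> nat \<times> nat" where
  "s_elem i = (i, Q_size i - 2)"

text \<open>The order is reflexive on its field before the transitive closure is taken, hence so is the
  closure. The value at \<open>0\<close> is a dummy.\<close>

fun P_poset :: "nat \<Rightarrow> (nat \<times> nat) rel" where
  "P_poset 0 = {}"
| "P_poset (Suc 0) = Q_chain 1"
| "P_poset (Suc (Suc n)) =
     (P_poset (Suc n) \<union> Q_chain (Suc (Suc n)) \<union> {(s_elem (Suc n), s_elem (Suc (Suc n)))})\<^sup>+"

end

theory Submission
  imports Defs
begin

text \<open>Let \<open>h\<close> be the height. By the Greene--Kleitman theorem some chain partition is both \<open>k\<close>- and
  \<open>(k + 1)\<close>-saturated. If \<open>d\<^sub>k + d\<^bsub>k+2\<^esub> \<ge> 2 d\<^bsub>k+1\<^esub>\<close>, then, as \<open>k \<mapsto> m\<^sub>k(\<C>)\<close> is concave, it is also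
  \<open>(k + 2)\<close>-saturated. Hence in a polyunsaturated poset the increments \<open>d\<^bsub>k+1\<^esub> - d\<^sub>k\<close> decrease strictly
  for \<open>1 \<le> k \<le> h - 2\<close>; since the last two, up to \<open>d\<^sub>h\<close>, are positive, summing gives
  \<open>d\<^sub>1 \<ge> h - 2\<close> and \<open>d\<^sub>h \<ge> h (h - 1) / 2\<close>, the width and cardinality of \<open>P\<^bsub>h-2\<^esub>\<close>.
  That \<open>P\<^sub>j\<close> itself is polyunsaturated follows from a 0-1-2 weighting of its elements, which shows
  \<open>m\<^sub>k(\<C>) + m\<^sub>l(\<C>) > d\<^sub>k + d\<^sub>l\<close> for every chain partition \<open>\<C>\<close> when \<open>l \<ge> k + 2\<close>.\<close>

section \<open>Bipartite matching and duality\<close>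

text \<open>Induction on \<open>S\<close>. If a nonempty proper subset \<open>J\<close> is tight,
  match it first; Hall's condition survives on \<open>S - J\<close> once the neighbours of
  \<open>J\<close> are removed. If none is tight, any single edge can be matched, since removing its
  endpoint \<open>y\<close> costs each neighbourhood at most one element.\<close>

lemma hall_marriage:
  fixes N :: "'a \<Rightarrow> 'b set"
  assumes "finite S" and "\<And>x. x \<in> S \<Longrightarrow> finite (N x)"
    and "\<And>J. J \<subseteq> S \<Longrightarrow> card J \<le> card (\<Union>(N ` J))"
  shows "\<exists>f. inj_on f S \<and> (\<forall>x\<in>S. f x \<in> N x)"
  using assms
proof (induction S arbitrary: N rule: finite_psubset_induct)
  case (psubset S)
  note fin = psubset.prems(1) and hall = psubset.prems(2)
  consider (empty) "S = {}"
    | (tight) J where "J \<subset> S" "J \<noteq> {}" "card (\<Union>(N ` J)) = card J"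
    | (slack) "S \<noteq> {}" "\<And>J. J \<subset> S \<Longrightarrow> J \<noteq> {} \<Longrightarrow> card J < card (\<Union>(N ` J))"
    using hall by (metis le_neq_implies_less psubset_imp_subset)
  then show ?case
  proof cases
    case empty
    then show ?thesis by auto
  next
    case tight
    have finJ: "finite J"
      using tight(1) psubset.hyps finite_subset by blast
    obtain f where f: "inj_on f J" "\<forall>x\<in>J. f x \<in> N x"
      using psubset.IH[OF tight(1), of N] fin hall tight(1) by (metis psubsetE subset_iff)
    define N' where "N' x = N x - \<Union>(N ` J)" for x
    have "\<exists>g. inj_on g (S - J) \<and> (\<forall>x\<in>S - J. g x \<in> N' x)"
    proof (rule psubset.IH)
      show "S - J \<subset> S" using tight by blast
      show "finite (N' x)" if "x \<in> S - J" for x using that fin by (auto simp: N'_def)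
      show "card K \<le> card (\<Union>(N' ` K))" if K: "K \<subseteq> S - J" for K
      proof -
        have fK: "finite K" using K psubset.hyps by (meson finite_Diff finite_subset)
        have eq: "\<Union>(N ` (J \<union> K)) = \<Union>(N ` J) \<union> \<Union>(N' ` K)" by (auto simp: N'_def)
        have "card J + card K = card (J \<union> K)"
          using K finJ fK by (subst card_Un_disjoint) auto
        also have "\<dots> \<le> card (\<Union>(N ` (J \<union> K)))" using K tight(1) by (intro hall) auto
        also have "\<dots> \<le> card (\<Union>(N ` J)) + card (\<Union>(N' ` K))"
          unfolding eq by (rule card_Un_le)
        finally show ?thesis using tight(3) by simp
      qed
    qed
    then obtain g where g: "inj_on g (S - J)" "\<forall>x\<in>S - J. g x \<in> N' x" by blast
    let ?h = "\<lambda>x. if x \<in> J then f x else g x"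
    have sep: "f x \<noteq> g y" if "x \<in> J" "y \<in> S - J" for x y
      using f(2) g(2) that by (auto simp: N'_def)
    have "inj_on ?h S"
      using f(1) g(1) sep by (auto simp: inj_on_def) (metis DiffI)+
    moreover have "\<forall>x\<in>S. ?h x \<in> N x"
      using f(2) g(2) by (simp add: N'_def)
    ultimately show ?thesis by blast
  next
    case slack
    obtain x where x: "x \<in> S" using slack(1) by blast
    have "N x \<noteq> {}" using hall[of "{x}"] x by auto
    then obtain y where y: "y \<in> N x" by blast
    define N' where "N' z = N z - {y}" for z
    have "\<exists>g. inj_on g (S - {x}) \<and> (\<forall>z\<in>S - {x}. g z \<in> N' z)"
    proof (rule psubset.IH)
      show "S - {x} \<subset> S" using x by blast
      show "finite (N' z)" if "z \<in> S - {x}" for z using that fin by (auto simp: N'_def)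
      show "card K \<le> card (\<Union>(N' ` K))" if K: "K \<subseteq> S - {x}" for K
      proof (cases "K = {}")
        case False
        have eq: "\<Union>(N' ` K) = \<Union>(N ` K) - {y}" by (auto simp: N'_def)
        have "card K < card (\<Union>(N ` K))" using K x False by (intro slack(2)) auto
        then show ?thesis unfolding eq by (auto simp: card_Diff_singleton_if)
      qed simp
    qed
    then obtain g where g: "inj_on g (S - {x})" "\<forall>z\<in>S - {x}. g z \<in> N' z" by blast
    have "inj_on (g(x := y)) S"
      using g by (auto simp: inj_on_def N'_def)
    moreover have "\<forall>z\<in>S. (g(x := y)) z \<in> N z"
      using g y by (auto simp: N'_def)
    ultimately show ?thesis by blast
  qed
qed

text \<open>Complementary slackness for the assignment problem: \<open>(u, v)\<close> is a cheapest
  integral cover of \<open>w\<close>, and Hall's theorem yields a perfect matching among its tight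
  pairs. Integrality lets unit changes of the cover suffice.\<close>

lemma egervary_duality:
  fixes w :: "'a \<Rightarrow> 'a \<Rightarrow> int"
  assumes "finite S"
  obtains u v \<sigma> where "bij_betw \<sigma> S S"
    and "\<And>x y. x \<in> S \<Longrightarrow> y \<in> S \<Longrightarrow> w x y \<le> u x + v y"
    and "\<And>x. x \<in> S \<Longrightarrow> u x + v (\<sigma> x) = w x (\<sigma> x)"
proof -
  define cover where
    "cover p \<longleftrightarrow> (\<forall>x\<in>S. \<forall>y\<in>S. w x y \<le> fst p x + snd p y)" for p :: "('a \<Rightarrow> int) \<times> ('a \<Rightarrow> int)"
  define cost where
    "cost p = (\<Sum>x\<in>S. fst p x + snd p x)" for p :: "('a \<Rightarrow> int) \<times> ('a \<Rightarrow> int)"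
  have lower: "(\<Sum>x\<in>S. w x x) \<le> cost p" if "cover p" for p
    using that unfolding cost_def cover_def by (intro sum_mono) auto
  have "w x y \<le> (\<Sum>y\<in>S. \<bar>w x y\<bar>)" if "y \<in> S" for x y
    using member_le_sum[of y S "\<lambda>y. \<bar>w x y\<bar>"] that assms by force
  then have "cover (\<lambda>x. \<Sum>y\<in>S. \<bar>w x y\<bar>, \<lambda>_. 0)" by (auto simp: cover_def)
  \<comment> \<open>Costs are integers bounded below by the diagonal weight; subtracting it turns
    them into naturals, where a minimum exists.\<close>
  then obtain p where p: "cover p"
    and least: "\<And>q. cover q \<Longrightarrow>
      nat (cost p - (\<Sum>x\<in>S. w x x)) \<le> nat (cost q - (\<Sum>x\<in>S. w x x))"
    using ex_has_least_nat[of cover _ "\<lambda>p. nat (cost p - (\<Sum>x\<in>S. w x x))"] by blast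
  have least: "cost p \<le> cost q" if "cover q" for q
    using least[OF that] lower[OF that] lower[OF p] by linarith
  obtain u v where uv: "p = (u, v)" by fastforce
  have cov: "w x y \<le> u x + v y" if "x \<in> S" "y \<in> S" for x y
    using p that by (simp add: cover_def uv)
  have count: "(\<Sum>x\<in>S. of_bool (x \<in> J)) = int (card J)" if "J \<subseteq> S" for J
    using that assms by (simp add: of_bool_def sum.If_cases Int_absorb1)
  define N where "N x = {y\<in>S. u x + v y = w x y}" for x
  have "\<exists>\<sigma>. inj_on \<sigma> S \<and> (\<forall>x\<in>S. \<sigma> x \<in> N x)"
  proof (rule hall_marriage)
    show "finite S" by fact
    show "finite (N x)" for x using assms by (simp add: N_def)
    show "card J \<le> card (\<Union>(N ` J))" if J: "J \<subseteq> S" for J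
    proof -
      \<comment> \<open>Otherwise lowering \<open>u\<close> on \<open>J\<close> and raising \<open>v\<close> on its tight neighbours
        gives a cheaper cover.\<close>
      let ?M = "\<Union>(N ` J)"
      let ?q = "(\<lambda>x. u x - of_bool (x \<in> J), \<lambda>y. v y + of_bool (y \<in> ?M))"
      have M: "?M \<subseteq> S" by (auto simp: N_def)
      have "cover ?q"
        unfolding cover_def
      proof (intro ballI)
        fix x y assume "x \<in> S" "y \<in> S"
        then show "w x y \<le> fst ?q x + snd ?q y"
          using cov[of x y] by (cases "x \<in> J"; cases "y \<in> ?M") (force simp: N_def)+
      qed
      then have "cost p \<le> cost ?q" by (rule least)
      also have "cost ?q = cost p - (\<Sum>x\<in>S. of_bool (x \<in> J)) + (\<Sum>y\<in>S. of_bool (y \<in> ?M))"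
        by (simp only: cost_def uv fst_conv snd_conv sum.distrib sum_subtractf)
      also have "\<dots> = cost p - int (card J) + int (card ?M)"
        by (simp only: count[OF J] count[OF M])
      finally show ?thesis by simp
    qed
  qed
  then obtain \<sigma> where \<sigma>: "inj_on \<sigma> S" "\<forall>x\<in>S. \<sigma> x \<in> N x" by blast
  have "\<sigma> ` S = S"
    using \<sigma> assms by (intro endo_inj_surj) (auto simp: N_def)
  then have "bij_betw \<sigma> S S" using \<sigma>(1) by (simp add: bij_betw_def)
  then show ?thesis
    using that[of \<sigma> u v] cov \<sigma>(2) by (auto simp: N_def)
qed

section \<open>Weak duality between antichain unions and chain partitions\<close>

lemma finite_Antichains: "finite (Field r) \<Longrightarrow> finite (Antichains r)"
  by (rule finite_subset[of _ "Pow (Field r)"]) (auto simp: Antichains_def)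

lemma Chains_subset_Field: "C \<in> Chains r \<Longrightarrow> C \<subseteq> Field r"
  by (auto simp: Chains_def Field_def)

lemma finite_Chains: "finite (Field r) \<Longrightarrow> finite (Chains r)"
  by (rule finite_subset[of _ "Pow (Field r)"]) (auto dest: Chains_subset_Field)

lemma card_le_height: "finite (Field r) \<Longrightarrow> C \<in> Chains r \<Longrightarrow> card C \<le> height r"
  by (auto simp: height_def finite_Chains)

lemma obtain_chain_card_height:
  assumes "finite (Field r)"
  obtains C where "C \<in> Chains r" "card C = height r"
proof -
  have "{} \<in> Chains r" by (simp add: Chains_def)
  then have "height r \<in> card ` Chains r"
    unfolding height_def using assms by (intro Max_in) (auto simp: finite_Chains)
  then show thesis using that by auto
qed

lemma card_le_width: "finite (Field r) \<Longrightarrow> A \<in> Antichains r \<Longrightarrow> card A \<le> width r"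
  by (auto simp: width_def finite_Antichains)

lemma antichain_unions_finite:
  fixes r :: "'a rel"
  assumes "finite (Field r)"
  shows "finite {card (\<Union>i<k. F i) | F :: nat \<Rightarrow> 'a set. \<forall>i<k. F i \<in> Antichains r}"
proof (rule finite_subset)
  show "{card (\<Union>i<k. F i) | F :: nat \<Rightarrow> 'a set. \<forall>i<k. F i \<in> Antichains r} \<subseteq> {..card (Field r)}"
    using assms by (auto simp: Antichains_def subset_eq intro!: card_mono)
qed simp

lemma card_le_max_antichain_union:
  assumes "finite (Field r)" "\<And>i. i < k \<Longrightarrow> F i \<in> Antichains r"
  shows "card (\<Union>i<k. F i) \<le> max_antichain_union k r"
  unfolding max_antichain_union_def
  using assms by (intro Max_ge antichain_unions_finite) blast+

lemma obtain_max_antichain_union: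
  fixes r :: "'a rel"
  assumes "finite (Field r)"
  obtains F where "\<And>i. i < k \<Longrightarrow> F i \<in> Antichains r"
    and "card (\<Union>i<k. F i) = max_antichain_union k r"
proof -
  let ?X = "{card (\<Union>i<k. F i) | F :: nat \<Rightarrow> 'a set. \<forall>i<k. F i \<in> Antichains r}"
  have "card (\<Union>i<k. {} :: 'a set) \<in> ?X"
    by (intro CollectI exI[of _ "\<lambda>_. {}"]) (simp add: Antichains_def)
  then have "?X \<noteq> {}" by (metis empty_iff)
  then have "max_antichain_union k r \<in> ?X"
    unfolding max_antichain_union_def
    using antichain_unions_finite[OF assms] by (intro Max_in)
  then show thesis using that by (smt (verit) mem_Collect_eq)
qed

lemma card_antichain_Int_chain_le:
  assumes "A \<in> Antichains r" "C \<in> Chains r"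
  shows "card (A \<inter> C) \<le> 1"
proof -
  have "x = y" if "x \<in> A \<inter> C" "y \<in> A \<inter> C" for x y
    using assms that unfolding Antichains_def Chains_def by blast
  then show ?thesis by (metis card_le_Suc0_iff_eq card.infinite One_nat_def zero_le)
qed

lemma card_antichain_union_Int_chain_le:
  assumes "\<And>i. i < k \<Longrightarrow> F i \<in> Antichains r" "C \<in> Chains r"
  shows "card ((\<Union>i<k. F i) \<inter> C) \<le> k"
proof -
  have "card ((\<Union>i<k. F i) \<inter> C) = card (\<Union>i\<in>{..<k}. F i \<inter> C)" by (rule arg_cong[where f = card]) auto
  also have "\<dots> \<le> (\<Sum>i<k. card (F i \<inter> C))" by (rule card_UN_le) simp
  also have "\<dots> \<le> (\<Sum>i<k. 1)" using assms by (intro sum_mono card_antichain_Int_chain_le) auto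
  finally show ?thesis by simp
qed

lemma card_eq_sum_partition:
  assumes "finite S" "partition_on S \<C>" "X \<subseteq> S"
  shows "card X = (\<Sum>C\<in>\<C>. card (X \<inter> C))"
proof -
  have "card (\<Union>C\<in>\<C>. X \<inter> C) = (\<Sum>C\<in>\<C>. card (X \<inter> C))"
  proof (rule card_UN_disjoint)
    show "finite \<C>" using assms by (simp add: finite_elements)
    show "\<forall>C\<in>\<C>. finite (X \<inter> C)" using assms finite_subset by blast
    show "\<forall>C\<in>\<C>. \<forall>D\<in>\<C>. C \<noteq> D \<longrightarrow> X \<inter> C \<inter> (X \<inter> D) = {}"
      using assms(2) unfolding partition_on_def disjoint_def by blast
  qed
  moreover have "(\<Union>C\<in>\<C>. X \<inter> C) = X"
    using assms(2,3) unfolding partition_on_def by blast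
  ultimately show ?thesis by simp
qed

text \<open>Each antichain meets a chain \<open>C\<close> at most once, so \<open>k\<close> of them
  occupy at most \<open>min k (card C)\<close> of its elements.\<close>

lemma max_antichain_union_le_truncated_size:
  assumes fin: "finite (Field r)" and "chain_partition r \<C>"
  shows "max_antichain_union k r \<le> truncated_size k \<C>"
proof -
  have part: "partition_on (Field r) \<C>" and ch: "\<C> \<subseteq> Chains r"
    using assms(2) by (auto simp: chain_partition_def)
  obtain F where F: "\<And>i. i < k \<Longrightarrow> F i \<in> Antichains r"
    and card: "card (\<Union>i<k. F i) = max_antichain_union k r"
    using obtain_max_antichain_union[OF fin] by metis
  let ?U = "\<Union>i<k. F i"
  have "card ?U = (\<Sum>C\<in>\<C>. card (?U \<inter> C))"
    using F by (intro card_eq_sum_partition[OF fin part]) (auto simp: Antichains_def)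
  also have "\<dots> \<le> (\<Sum>C\<in>\<C>. min k (card C))"
  proof (rule sum_mono)
    fix C assume "C \<in> \<C>"
    then have C: "C \<in> Chains r" using ch by blast
    then have "finite C" using fin Chains_subset_Field finite_subset by blast
    then show "card (?U \<inter> C) \<le> min k (card C)"
      using card_antichain_union_Int_chain_le[where F = F, OF F C] by (simp add: card_mono)
  qed
  finally show ?thesis by (simp add: card truncated_size_def)
qed

section \<open>The Greene--Kleitman theorem\<close>

text \<open>\<open>E\<close> links elements into ascending paths, and \<open>D x\<close> is the path
  with top \<open>x\<close> outside \<open>Domain E\<close>. Single-valuedness of \<open>E\<close>
  keeps paths with different tops disjoint; that of its converse makes each path a chain. As
  \<open>E\<close> is finite and acyclic, every upward walk reaches a top.\<close>

lemma chain_partition_of_injective_relation: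
  assumes fin: "finite (Field r)" and po: "Partial_order r"
    and E: "E \<subseteq> r - Id" and sv: "single_valued E" and svc: "single_valued (E\<inverse>)"
  defines "D \<equiv> \<lambda>x. {y. (y, x) \<in> E\<^sup>*}"
  shows "inj_on D (Field r - Domain E)"
    and "chain_partition r (D ` (Field r - Domain E))"
proof -
  have refl: "(x, x) \<in> r" if "x \<in> Field r" for x
    using po that by (auto simp: partial_order_on_def preorder_on_def refl_on_def)
  have tr: "trans r" and anti: "antisym r"
    using po by (auto simp: partial_order_on_def preorder_on_def)
  have Etr: "E\<^sup>+ \<subseteq> r"
    using E tr by (metis Diff_subset subset_trans trancl_id trancl_mono_subset)
  have Er: "(y, x) \<in> r" if "(y, x) \<in> E\<^sup>*" "x \<in> Field r" for x y
    using that Etr refl by (metis rtranclD subset_iff)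
  have FE: "y \<in> Field r" if "(y, x) \<in> E\<^sup>*" "x \<in> Field r" for x y
    using Er[OF that] by (auto simp: Field_def)
  have "acyclic E"
  proof (rule acyclicI, intro allI notI)
    fix x assume "(x, x) \<in> E\<^sup>+"
    then obtain z where z: "(x, z) \<in> E" "(z, x) \<in> E\<^sup>*" by (meson tranclD)
    then have "(x, z) \<in> r" "x \<noteq> z" using E by auto
    moreover have "(z, x) \<in> r" using Er[OF z(2)] \<open>(x, z) \<in> r\<close> by (auto simp: Field_def)
    ultimately show False using anti by (auto dest: antisymD)
  qed
  moreover have "finite E"
    using E fin by (intro finite_subset[of E "Field r \<times> Field r"]) (auto simp: Field_def)
  ultimately have wf: "wf (E\<inverse>)" by (rule finite_acyclic_wf_converse[rotated])
  have reach: "\<exists>x\<in>Field r - Domain E. (y, x) \<in> E\<^sup>*" if "y \<in> Field r" for y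
    using wf that
  proof (induction y rule: wf_induct_rule)
    case (less y)
    show ?case
    proof (cases "y \<in> Domain E")
      case True
      then obtain z where z: "(y, z) \<in> E" by blast
      then have "z \<in> Field r" using E by (auto simp: Field_def)
      then show ?thesis using less.IH[of z] z by (meson converseI converse_rtrancl_into_rtrancl)
    qed (use less.prems in auto)
  qed
  have top: "x = z" if "x \<notin> Domain E" "(x, z) \<in> E\<^sup>*" for x z
    using that by (metis Domain.DomainI converse_rtranclE)
  have eq: "x = x'" if "x \<notin> Domain E" "x' \<notin> Domain E" "y \<in> D x" "y \<in> D x'" for x x' y
    using that single_valued_confluent[OF sv, of y x x'] top unfolding D_def by blast
  have self: "x \<in> D x" for x by (simp add: D_def)
  show "inj_on D (Field r - Domain E)"
    using eq self by (metis DiffE inj_onI)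
  have "D x \<in> Chains r" if x: "x \<in> Field r" for x
    unfolding Chains_def D_def
  proof (safe)
    fix y z assume yz: "(y, x) \<in> E\<^sup>*" "(z, x) \<in> E\<^sup>*" "(z, y) \<notin> r"
    then have "(y, z) \<in> E\<^sup>* \<or> (z, y) \<in> E\<^sup>*"
      using single_valued_confluent[OF svc, of x y z] by (auto simp: rtrancl_converse)
    then show "(y, z) \<in> r" using yz Er FE x by blast
  qed
  moreover have "partition_on (Field r) (D ` (Field r - Domain E))"
  proof (rule partition_onI)
    show "\<Union>(D ` (Field r - Domain E)) = Field r"
      using reach FE by (fastforce simp: D_def)
    show "{} \<notin> D ` (Field r - Domain E)"
      using self by auto
    show "disjnt p q" if "p \<in> D ` (Field r - Domain E)" "q \<in> D ` (Field r - Domain E)" "p \<noteq> q" for p q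
      using that eq by (auto simp: disjnt_def)
  qed
  ultimately show "chain_partition r (D ` (Field r - Domain E))"
    by (auto simp: chain_partition_def)
qed

text \<open>Weigh a loop \<open>(x, x)\<close> by \<open>2k - 1\<close> and a strict comparability by \<open>2k + 1\<close>. An optimal
  assignment \<open>\<sigma>\<close> chains the elements \<open>x < \<sigma> x\<close> together. An optimal dual \<open>(u, v)\<close> gives each \<open>x\<close> the
  interval of levels in \<open>{v x<..2k + 1 - u x}\<close>, which lies below that of any larger element and has
  at most two levels; hence the odd levels are \<open>k + 1\<close> and the even levels \<open>k\<close> antichains.\<close>

theorem greene_kleitman:
  fixes r :: "'a rel"
  assumes "finite_poset r" and k: "0 < k"
  obtains \<C> where "chain_partition r \<C>" "saturated k r \<C>" "saturated (Suc k) r \<C>"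
proof -
  let ?F = "Field r"
  have fin: "finite ?F" and po: "Partial_order r"
    using assms(1) by (auto simp: finite_poset_def)
  define w :: "'a \<Rightarrow> 'a \<Rightarrow> int" where
    "w x y = (if x = y then 2 * int k - 1 else if (x, y) \<in> r then 2 * int k + 1 else 0)" for x y
  obtain u v \<sigma> where \<sigma>: "bij_betw \<sigma> ?F ?F"
    and cov: "\<And>x y. x \<in> ?F \<Longrightarrow> y \<in> ?F \<Longrightarrow> w x y \<le> u x + v y"
    and tight: "\<And>x. x \<in> ?F \<Longrightarrow> u x + v (\<sigma> x) = w x (\<sigma> x)"
    using egervary_duality[OF fin, of w] by metis
  have dual_value: "(\<Sum>x\<in>?F. 2 * int k + 1 - u x - v x) = (\<Sum>x\<in>?F. 2 * int k + 1 - w x (\<sigma> x))"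
  proof -
    have "(\<Sum>x\<in>?F. v x) = (\<Sum>x\<in>?F. v (\<sigma> x))"
      using sum.reindex_bij_betw[OF \<sigma>, of v] by simp
    moreover have "(\<Sum>x\<in>?F. u x + v (\<sigma> x)) = (\<Sum>x\<in>?F. w x (\<sigma> x))"
      using tight by (rule sum.cong[OF refl])
    ultimately show ?thesis by (simp add: sum_subtractf sum.distrib)
  qed
  have lower: "(\<Sum>x\<in>?F. 2 * int k + 1 - u x - v x)
      \<le> int (max_antichain_union k r) + int (max_antichain_union (Suc k) r)"
  proof -
    \<comment> \<open>Moving the constant \<open>c\<close>, the minimum of \<open>v\<close>, from
      \<open>v\<close> to \<open>u\<close> keeps every sum \<open>u x + v y\<close>. Since
      \<open>w\<close> is nonnegative, all level intervals then lie in
      \<open>{0<..2 * int k + 1}\<close>.\<close>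
    obtain c where c: "\<And>x. x \<in> ?F \<Longrightarrow> c \<le> v x" "\<And>x. x \<in> ?F \<Longrightarrow> 0 \<le> u x + c"
    proof (cases "?F = {}")
      case False
      then obtain y where y: "y \<in> ?F" "\<And>x. x \<in> ?F \<Longrightarrow> v y \<le> v x"
        using fin arg_min_if_finite[OF fin False, of v] arg_min_least[OF fin False, of _ v] by metis
      have "0 \<le> u x + v y" if "x \<in> ?F" for x
        using cov[OF that y(1)] k by (auto simp: w_def split: if_splits)
      with y show ?thesis using that by blast
    qed auto
    define lo hi where "lo x = v x - c" and "hi x = 2 * int k + 1 - (u x + c)" for x
    have lo: "0 \<le> lo x" and hi: "hi x \<le> 2 * int k + 1" and len: "hi x \<le> lo x + 2" if "x \<in> ?F" for x
      using c[OF that] cov[OF that that] by (auto simp: lo_def hi_def w_def)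
    have sep: "hi x \<le> lo y" if "(x, y) \<in> r" "x \<noteq> y" for x y
      using cov[of x y] that by (auto simp: lo_def hi_def w_def FieldI1 FieldI2)
    define A where "A t = {x\<in>?F. lo x < t \<and> t \<le> hi x}" for t
    have anti: "A t \<in> Antichains r" for t
      unfolding Antichains_def A_def using sep by fastforce
    let ?E = "\<Union>i<k. A (2 * int i + 2)" and ?O = "\<Union>i<Suc k. A (2 * int i + 1)"
    \<comment> \<open>A nonempty interval has one or two levels, and two consecutive levels have
      opposite parity, so they are counted once each by \<open>?E\<close> and
      \<open>?O\<close>.\<close>
    have levels: "hi x - lo x \<le> of_bool (x \<in> ?E) + of_bool (x \<in> ?O)" if x: "x \<in> ?F" for x
    proof -
      have E: "x \<in> ?E" if t: "lo x < t" "t \<le> hi x" "even t" for t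
      proof -
        have "0 < t" "t \<le> 2 * int k + 1" using t lo[OF x] hi[OF x] by auto
        then obtain i where "t = 2 * int i + 2" "i < k"
          using t(3) by (intro that[of "nat (t div 2 - 1)"]) (auto elim!: evenE)
        then show ?thesis using t(1,2) x by (auto simp: A_def)
      qed
      have O: "x \<in> ?O" if t: "lo x < t" "t \<le> hi x" "odd t" for t
      proof -
        have "0 < t" "t \<le> 2 * int k + 1" using t lo[OF x] hi[OF x] by auto
        then obtain i where "t = 2 * int i + 1" "i < Suc k"
          using t(3) by (intro that[of "nat (t div 2)"]) (auto elim!: oddE)
        then show ?thesis using t(1,2) x by (auto simp: A_def)
      qed
      consider "hi x \<le> lo x" | "hi x = lo x + 1" | "hi x = lo x + 2"
        using len[OF x] by linarith
      then show ?thesis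
      proof cases
        case 1
        then show ?thesis by (simp add: order.trans[of _ 0])
      next
        case 2
        then have "x \<in> ?E \<or> x \<in> ?O" using E[of "hi x"] O[of "hi x"] by linarith
        then show ?thesis unfolding 2 by auto
      next
        case 3
        then have "x \<in> ?E \<and> x \<in> ?O"
          using E[of "hi x"] O[of "hi x"] E[of "lo x + 1"] O[of "lo x + 1"]
          by (cases "even (lo x)") auto
        then show ?thesis unfolding 3 by auto
      qed
    qed
    have count: "(\<Sum>x\<in>?F. of_bool (x \<in> U)) = int (card U)" if "U \<subseteq> ?F" for U
      using that fin by (simp add: of_bool_def sum.If_cases Int_absorb1)
    have "(\<Sum>x\<in>?F. 2 * int k + 1 - u x - v x) = (\<Sum>x\<in>?F. hi x - lo x)"
      by (simp add: hi_def lo_def algebra_simps)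
    also have "\<dots> \<le> (\<Sum>x\<in>?F. of_bool (x \<in> ?E) + of_bool (x \<in> ?O))"
      by (intro sum_mono levels)
    also have "\<dots> = int (card ?E) + int (card ?O)"
      unfolding sum.distrib by (intro arg_cong2[where f = "(+)"] count) (auto simp: A_def)
    also have "\<dots> \<le> int (max_antichain_union k r) + int (max_antichain_union (Suc k) r)"
      using card_le_max_antichain_union[OF fin, of k "\<lambda>i. A (2 * int i + 2)"]
        card_le_max_antichain_union[OF fin, of "Suc k" "\<lambda>i. A (2 * int i + 1)"] anti by simp
    finally show ?thesis .
  qed
  \<comment> \<open>Fixed points of \<open>\<sigma>\<close> and pairs of weight zero give no link;
    such \<open>x\<close> become the tops of the chains.\<close>
  define E where "E = {(x, \<sigma> x) | x. x \<in> ?F \<and> x \<noteq> \<sigma> x \<and> (x, \<sigma> x) \<in> r}"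
  have inj: "inj_on \<sigma> ?F" using \<sigma> by (simp add: bij_betw_def)
  have "E \<subseteq> r - Id" "single_valued E" "single_valued (E\<inverse>)"
    using inj by (auto simp: E_def single_valued_def dest: inj_onD)
  note dec = chain_partition_of_injective_relation[OF fin po this]
  define D where "D = (\<lambda>x. {y. (y, x) \<in> E\<^sup>*})"
  define \<C> where "\<C> = D ` (?F - Domain E)"
  have C: "chain_partition r \<C>" and injD: "inj_on D (?F - Domain E)"
    using dec by (simp_all only: \<C>_def D_def)
  let ?m = "\<lambda>C :: 'a set. int (min k (card C) + min (Suc k) (card C))"
  have "int (truncated_size k \<C>) + int (truncated_size (Suc k) \<C>) = (\<Sum>C\<in>\<C>. ?m C)"
    by (simp add: truncated_size_def sum.distrib)
  also have "\<dots> = (\<Sum>x\<in>?F - Domain E. ?m (D x))"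
    by (simp only: \<C>_def sum.reindex[OF injD] o_def)
  \<comment> \<open>Each chain is paid for by its top \<open>x\<close>. It counts at most
    \<open>2 * k + 1\<close>, which is the summand when \<open>w x (\<sigma> x) = 0\<close>; at a
    fixed point the chain is \<open>{x}\<close> and counts 2, again the summand.\<close>
  also have "\<dots> \<le> (\<Sum>x\<in>?F - Domain E. 2 * int k + 1 - w x (\<sigma> x))"
  proof (rule sum_mono)
    fix x assume x: "x \<in> ?F - Domain E"
    show "?m (D x) \<le> 2 * int k + 1 - w x (\<sigma> x)"
    proof (cases "\<sigma> x = x")
      case True
      have "y = x" if "(y, x) \<in> E\<^sup>*" for y
        using that
      proof (cases rule: rtranclE)
        case (step z)
        then have "z \<in> ?F" "\<sigma> z = x" "z \<noteq> x" by (auto simp: E_def)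
        then show ?thesis using True inj x by (auto dest: inj_onD)
      qed
      then have "D x = {x}" by (auto simp: D_def)
      then show ?thesis using True k by (simp add: w_def)
    next
      case False
      then have "w x (\<sigma> x) = 0" using x by (auto simp: w_def E_def)
      then show ?thesis by simp
    qed
  qed
  \<comment> \<open>Each \<open>x\<close> in \<open>Domain E\<close> has weight
    \<open>2 * int k + 1\<close> and contributes zero.\<close>
  also have "\<dots> = (\<Sum>x\<in>?F. 2 * int k + 1 - w x (\<sigma> x))"
    using fin by (intro sum.mono_neutral_left) (auto simp: E_def w_def)
  finally have "truncated_size k \<C> + truncated_size (Suc k) \<C>
      \<le> max_antichain_union k r + max_antichain_union (Suc k) r"
    using lower unfolding dual_value by linarith
  then have "saturated k r \<C> \<and> saturated (Suc k) r \<C>"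
    using max_antichain_union_le_truncated_size[OF fin C, of k]
      max_antichain_union_le_truncated_size[OF fin C, of "Suc k"]
    unfolding saturated_def by linarith
  then show thesis using that C by blast
qed

section \<open>Lower bounds for polyunsaturated posets\<close>

text \<open>A longest chain is not covered by \<open>k < height r\<close> antichains; an element
  they miss forms one further antichain.\<close>

lemma max_antichain_union_mono_Suc:
  fixes r :: "'a rel"
  assumes fin: "finite (Field r)" and po: "Partial_order r" and k: "k < height r"
  shows "Suc (max_antichain_union k r) \<le> max_antichain_union (Suc k) r"
proof -
  obtain F where F: "\<And>i. i < k \<Longrightarrow> F i \<in> Antichains r"
    and card: "card (\<Union>i<k. F i) = max_antichain_union k r"
    using obtain_max_antichain_union[OF fin] by metis
  obtain C where C: "C \<in> Chains r" "card C = height r"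
    using obtain_chain_card_height[OF fin] .
  let ?U = "\<Union>i<k. F i"
  have "\<not> C \<subseteq> ?U"
    using card_antichain_union_Int_chain_le[where F = F and C = C and k = k, OF F C(1)] C(2) k
    by (auto simp: Int_absorb1)
  then obtain x where x: "x \<in> C" "x \<notin> ?U" by blast
  define G where "G i = (if i < k then F i else {x})" for i
  have "card (\<Union>i<Suc k. G i) \<le> max_antichain_union (Suc k) r"
  proof (rule card_le_max_antichain_union[OF fin])
    show "G i \<in> Antichains r" if "i < Suc k" for i
      using F x(1) Chains_subset_Field[OF C(1)] by (auto simp: G_def Antichains_def)
  qed
  moreover have "(\<Union>i<Suc k. G i) = insert x ?U" by (auto simp: G_def less_Suc_eq)
  moreover have "finite ?U"
    using F fin by (intro finite_UN_I) (auto simp: Antichains_def intro: finite_subset)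
  ultimately show ?thesis using x(2) card by simp
qed

lemma max_antichain_union_le_mult_width:
  fixes r :: "'a rel"
  assumes fin: "finite (Field r)"
  shows "max_antichain_union k r \<le> k * width r"
proof -
  obtain F where F: "\<And>i. i < k \<Longrightarrow> F i \<in> Antichains r"
    and card: "card (\<Union>i<k. F i) = max_antichain_union k r"
    using obtain_max_antichain_union[OF fin] by metis
  have "card (\<Union>i\<in>{..<k}. F i) \<le> (\<Sum>i<k. card (F i))" by (rule card_UN_le) simp
  also have "\<dots> \<le> (\<Sum>i<k. width r)" using F by (intro sum_mono card_le_width fin) auto
  finally show ?thesis using card by simp
qed

lemma max_antichain_union_one:
  fixes r :: "'a rel"
  assumes fin: "finite (Field r)"
  shows "max_antichain_union 1 r = width r"
proof (rule antisym)
  show "max_antichain_union 1 r \<le> width r"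
    using max_antichain_union_le_mult_width[OF fin, of 1] by simp
  have "{} \<in> Antichains r" by (simp add: Antichains_def)
  then have "width r \<in> card ` Antichains r"
    unfolding width_def by (intro Max_in) (auto simp: finite_Antichains[OF fin])
  then show "width r \<le> max_antichain_union 1 r"
    using card_le_max_antichain_union[OF fin, of 1 "\<lambda>_. A" for A]
    by (auto simp: lessThan_Suc)
qed

lemma max_antichain_union_le_card_Field:
  fixes r :: "'a rel"
  assumes fin: "finite (Field r)"
  shows "max_antichain_union k r \<le> card (Field r)"
proof -
  obtain F where F: "\<And>i. i < k \<Longrightarrow> F i \<in> Antichains r"
    and card: "card (\<Union>i<k. F i) = max_antichain_union k r"
    using obtain_max_antichain_union[OF fin] by metis
  have "(\<Union>i<k. F i) \<subseteq> Field r" using F by (auto simp: Antichains_def)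
  then show ?thesis using card card_mono[OF fin] by metis
qed

lemma truncated_size_concave:
  "truncated_size k \<C> + truncated_size (Suc (Suc k)) \<C> \<le> 2 * truncated_size (Suc k) \<C>"
  unfolding truncated_size_def sum_distrib_left sum.distrib[symmetric] by (intro sum_mono) (simp add: min_def)

lemma polyunsaturated_strictly_concave:
  assumes poly: "polyunsaturated r" and k: "0 < k" "Suc (Suc k) < height r"
  shows "max_antichain_union k r + max_antichain_union (Suc (Suc k)) r
    < 2 * max_antichain_union (Suc k) r"
proof (rule ccontr)
  assume contra: "\<not> ?thesis"
  have fp: "finite_poset r" using poly by (simp add: polyunsaturated_def)
  then have fin: "finite (Field r)" by (simp add: finite_poset_def)
  obtain \<C> where \<C>: "chain_partition r \<C>" "saturated k r \<C>" "saturated (Suc k) r \<C>"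
    using greene_kleitman[OF fp k(1)] .
  \<comment> \<open>Concavity bounds the truncated size at \<open>k + 2\<close> by
    \<open>2 * d_(k+1) - d_k\<close>, hence by \<open>d_(k+2)\<close>; weak duality gives the
    reverse inequality.\<close>
  then have "saturated (Suc (Suc k)) r \<C>"
    using contra truncated_size_concave[of k \<C>]
      max_antichain_union_le_truncated_size[OF fin \<C>(1), of "Suc (Suc k)"]
    unfolding saturated_def by linarith
  then have "0 < k \<and> k < height r \<and> 0 < Suc (Suc k) \<and> Suc (Suc k) < height r \<and> k \<noteq> Suc (Suc k) \<and>
      k \<noteq> Suc (Suc (Suc k)) \<and> Suc (Suc k) \<noteq> Suc k \<and>
      (\<exists>\<C>. chain_partition r \<C> \<and> saturated k r \<C> \<and> saturated (Suc (Suc k)) r \<C>)"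
    using k \<C> by auto
  then show False
    using poly unfolding polyunsaturated_def by blast
qed

theorem polyunsaturated_lower_bounds:
  assumes poly: "polyunsaturated r" and h: "height r = j + 2" and j: "1 \<le> j"
  shows "j \<le> width r" and "(j + 1) * (j + 2) \<le> 2 * card (Field r)"
proof -
  let ?d = "\<lambda>k. max_antichain_union k r"
  have fin: "finite (Field r)" and po: "Partial_order r"
    using poly by (auto simp: polyunsaturated_def finite_poset_def)
  \<comment> \<open>Increments are counted downwards from \<open>?d (Suc j) - ?d j\<close>, which is
    positive, and strict concavity adds at least one each time. The last increment, up to
    \<open>?d (Suc (Suc j))\<close>, lies beyond the range of strict concavity and enters
    separately.\<close>
  have diff: "?d (j - i) + Suc i \<le> ?d (Suc j - i)" if "i < j" for i
    using that
  proof (induction i)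
    case 0
    then show ?case using max_antichain_union_mono_Suc[OF fin po, of j] h by simp
  next
    case (Suc i)
    have "?d (j - Suc i) + ?d (Suc (Suc (j - Suc i))) < 2 * ?d (Suc (j - Suc i))"
      using Suc.prems h by (intro polyunsaturated_strictly_concave[OF poly]) auto
    then show ?case
      using Suc by (simp add: Suc_diff_Suc Suc_diff_le)
  qed
  have d1: "?d 1 = width r" by (rule max_antichain_union_one[OF fin])
  \<comment> \<open>For \<open>i = j - 1\<close> this reads \<open>?d 1 + j \<le> ?d 2\<close>, and
    \<open>?d 2 \<le> 2 * ?d 1\<close>.\<close>
  have width: "j \<le> ?d 1"
    using diff[of "j - 1"] max_antichain_union_le_mult_width[OF fin, of 2] d1 j
    by (simp add: numeral_2_eq_2)
  then show "j \<le> width r" using d1 by simp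
  \<comment> \<open>Telescoping: the top \<open>i\<close> increments add up to at least
    \<open>1 + 2 + ... + i\<close>.\<close>
  have "2 * ?d (Suc j - i) + i * Suc i \<le> 2 * ?d (Suc j)" if "i \<le> j" for i
    using that
  proof (induction i)
    case (Suc i)
    then show ?case using diff[of i] by simp
  qed simp
  from this[of j] have "2 * ?d 1 + j * Suc j \<le> 2 * ?d (Suc j)" by simp
  moreover have "Suc (?d (Suc j)) \<le> ?d (Suc (Suc j))"
    using max_antichain_union_mono_Suc[OF fin po, of "Suc j"] h by simp
  moreover have "?d (Suc (Suc j)) \<le> card (Field r)"
    by (rule max_antichain_union_le_card_Field[OF fin])
  ultimately show "(j + 1) * (j + 2) \<le> 2 * card (Field r)"
    using width by (simp add: algebra_simps)
qed

section \<open>The posets \<open>P\<^sub>j\<close>\<close>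

definition P_elems :: "nat \<Rightarrow> (nat \<times> nat) set" where
  "P_elems j = (SIGMA i:{1..j}. {..<Q_size i})"

text \<open>Closed form of the transitive closure: the only passage from \<open>Q_i\<close> to a
  later \<open>Q_i'\<close> runs along the elements \<open>s_i, ..., s_i'\<close>.\<close>

definition P_le :: "nat \<times> nat \<Rightarrow> nat \<times> nat \<Rightarrow> bool" where
  "P_le x y \<longleftrightarrow> fst x = fst y \<and> snd x \<le> snd y \<or>
     fst x < fst y \<and> snd x \<le> Q_size (fst x) - 2 \<and> Q_size (fst y) - 2 \<le> snd y"

lemma P_le_trans: "P_le x y \<Longrightarrow> P_le y z \<Longrightarrow> P_le x z"
  unfolding P_le_def by auto

lemma P_poset_eq: "P_poset j = {(x, y). x \<in> P_elems j \<and> y \<in> P_elems j \<and> P_le x y}"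
proof (induction j rule: P_poset.induct)
  case 1
  show ?case by (simp add: P_elems_def)
next
  case 2
  show ?case by (auto simp: P_elems_def P_le_def Q_chain_def)
next
  case (3 n)
  let ?G = "\<lambda>j. {(x, y). x \<in> P_elems j \<and> y \<in> P_elems j \<and> P_le x y}"
  let ?j = "Suc (Suc n)"
  let ?R = "P_poset (Suc n) \<union> Q_chain ?j \<union> {(s_elem (Suc n), s_elem ?j)}"
  have "?R\<^sup>+ = ?G ?j"
  proof (rule antisym)
    have "trans (?G ?j)"
      by (rule transI) (auto intro: P_le_trans)
    moreover have "?R \<subseteq> ?G ?j"
      unfolding 3 by (auto simp: P_elems_def P_le_def Q_chain_def s_elem_def Q_size_def)
    ultimately show "?R\<^sup>+ \<subseteq> ?G ?j"
      by (rule subset_trans[OF trancl_mono_subset eq_refl[OF trancl_id], rotated])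
  next
    show "?G ?j \<subseteq> ?R\<^sup>+"
    proof (clarify)
      fix i a i' b
      assume x: "(i, a) \<in> P_elems ?j" and y: "(i', b) \<in> P_elems ?j" and le: "P_le (i, a) (i', b)"
      have ii: "i \<le> i'" using le by (auto simp: P_le_def)
      consider "i' \<le> Suc n" | "i = ?j" | "i \<le> Suc n" "i' = ?j"
        using x y ii by (fastforce simp: P_elems_def)
      then show "((i, a), (i', b)) \<in> ?R\<^sup>+"
      proof cases
        case 1
        then have "((i, a), (i', b)) \<in> P_poset (Suc n)"
          using x y le ii unfolding 3 by (auto simp: P_elems_def)
        then show ?thesis by blast
      next
        case 2
        then have "((i, a), (i', b)) \<in> Q_chain ?j"
          using x y le by (auto simp: P_elems_def P_le_def Q_chain_def)
        then show ?thesis by blast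
      next
        case 3
        \<comment> \<open>A relation from an older chain into the new one factors through the new
          cover relation.\<close>
        have "((i, a), s_elem (Suc n)) \<in> P_poset (Suc n)"
          using x le 3 unfolding "3.IH"
          by (auto simp: P_elems_def P_le_def s_elem_def Q_size_def)
        moreover have "(s_elem ?j, (i', b)) \<in> Q_chain ?j"
          using y le 3 by (auto simp: P_elems_def P_le_def s_elem_def Q_chain_def)
        ultimately have "((i, a), s_elem (Suc n)) \<in> ?R\<^sup>+" "(s_elem (Suc n), s_elem ?j) \<in> ?R\<^sup>+"
          "(s_elem ?j, (i', b)) \<in> ?R\<^sup>+" by blast+
        then show ?thesis by (meson trancl_trans)
      qed
    qed
  qed
  then show ?case by simp
qed

lemma Field_P_poset: "Field (P_poset j) = P_elems j"
proof
  show "Field (P_poset j) \<subseteq> P_elems j" by (auto simp: P_poset_eq Field_def)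
  have "(x, x) \<in> P_poset j" if "x \<in> P_elems j" for x
    using that by (simp add: P_poset_eq P_le_def)
  then show "P_elems j \<subseteq> Field (P_poset j)" by (auto intro: FieldI1)
qed

lemma finite_P_elems: "finite (P_elems j)"
  by (simp add: P_elems_def)

lemma finite_poset_P_poset: "finite_poset (P_poset j)"
  unfolding finite_poset_def Field_P_poset partial_order_on_def preorder_on_def
proof (intro conjI)
  show "refl_on (P_elems j) (P_poset j)"
    by (auto simp: refl_on_def P_poset_eq P_le_def)
  show "trans (P_poset j)"
    by (rule transI) (auto simp: P_poset_eq intro: P_le_trans)
  show "antisym (P_poset j)"
    by (rule antisymI) (auto simp: P_poset_eq P_le_def)
  show "P_poset j \<subseteq> P_elems j \<times> P_elems j" by (auto simp: P_poset_eq)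
qed (rule finite_P_elems)

lemma card_P_elems: "2 * card (P_elems j) = (if j = 0 then 0 else (j + 1) * (j + 2))"
proof -
  have "card (P_elems j) = (\<Sum>i=1..j. Q_size i)"
    by (simp add: P_elems_def)
  also have "2 * \<dots> = (if j = 0 then 0 else (j + 1) * (j + 2))"
    by (induction j) (auto simp: Q_size_def)
  finally show ?thesis .
qed

section \<open>Chains, ranks and height\<close>

lemma Chains_P_poset_iff:
  "C \<in> Chains (P_poset j) \<longleftrightarrow> C \<subseteq> P_elems j \<and> (\<forall>x\<in>C. \<forall>y\<in>C. P_le x y \<or> P_le y x)"
  unfolding Chains_def P_poset_eq by auto

text \<open>The elements \<open>u < s\<^sub>1 < \<dots> < s\<^sub>m < r\<^sub>m\<close>.\<close>

definition long_chain :: "nat \<Rightarrow> (nat \<times> nat) set" where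
  "long_chain m = {(1, 0), (m, Q_size m - 1)} \<union> s_elem ` {1..m}"

lemma long_chain:
  assumes "1 \<le> m" "m \<le> j"
  shows "long_chain m \<in> Chains (P_poset j)" and "card (long_chain m) = m + 2"
    and "long_chain m \<subseteq> P_elems m"
proof -
  have "inj_on s_elem {1..m}" by (auto simp: inj_on_def s_elem_def)
  then have "card (s_elem ` {1..m}) = m" by (simp add: card_image)
  moreover have "(1, 0) \<notin> s_elem ` {1..m}" "(m, Q_size m - 1) \<notin> s_elem ` {1..m}"
    "(1, 0) \<noteq> (m, Q_size m - 1)"
    by (auto simp: s_elem_def Q_size_def split: if_splits)
  ultimately show "card (long_chain m) = m + 2" by (simp add: long_chain_def)
  show sub: "long_chain m \<subseteq> P_elems m"
    using assms by (auto simp: long_chain_def s_elem_def P_elems_def Q_size_def)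
  have "P_elems m \<subseteq> P_elems j" using assms by (auto simp: P_elems_def)
  then show "long_chain m \<in> Chains (P_poset j)"
    unfolding Chains_P_poset_iff using sub assms
    by (auto simp: long_chain_def s_elem_def P_le_def Q_size_def)
qed

text \<open>A rank function giving \<open>s\<^sub>i\<close> the rank \<open>i\<close> and every \<open>r\<^sub>i\<close> the rank \<open>L\<close>.\<close>

definition P_rank :: "nat \<Rightarrow> nat \<times> nat \<Rightarrow> nat" where
  "P_rank L x = (if snd x = Q_size (fst x) - 1 then L
     else if snd x = Q_size (fst x) - 2 then fst x else snd x)"

text \<open>Elements of \<open>T_i\<close> have \<open>snd x < i\<close>, so the rank rises on the
  way to \<open>s_i\<close> and along the \<open>s_i\<close>. Only the step to a maximal
  \<open>r_i\<close>, whose rank is the free parameter \<open>L\<close>, has to be assumed.\<close>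

lemma P_rank_strict_mono:
  assumes "x \<in> P_elems j" "y \<in> P_elems j" "P_le x y" "x \<noteq> y"
    and "snd y = Q_size (fst y) - 1 \<Longrightarrow> P_rank L x < L"
  shows "P_rank L x < P_rank L y"
proof (cases "snd y = Q_size (fst y) - 1")
  case True
  then show ?thesis using assms(5) by (simp add: P_rank_def)
next
  case False
  obtain i a i' b where xy: "x = (i, a)" "y = (i', b)" by fastforce
  have q: "3 \<le> Q_size i" "3 \<le> Q_size i'" by (use assms in \<open>auto simp: P_elems_def xy Q_size_def\<close>)
  have less: "a < i" if "a < Q_size i - 2"
    using that assms(1) by (auto simp: P_elems_def xy Q_size_def split: if_splits)
  have b: "b \<le> Q_size i' - 2" using False assms(2) by (auto simp: P_elems_def xy)
  consider "i = i'" "a < b" | "i < i'" "a \<le> Q_size i - 2" "b = Q_size i' - 2"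
    using assms(3,4) b by (auto simp: P_le_def xy)
  then show ?thesis
    by cases (use less b q in \<open>auto simp: P_rank_def xy\<close>)
qed

lemma P_le_not_top:
  assumes "x \<in> P_elems j" "P_le x y" "x \<noteq> y" "y \<in> P_elems j"
  shows "snd x \<noteq> Q_size (fst x) - 1"
proof -
  have "3 \<le> Q_size (fst x)" using assms(1) by (auto simp: P_elems_def Q_size_def)
  then show ?thesis
    using assms(2-4) by (cases x; cases y) (auto simp: P_elems_def P_le_def)
qed

text \<open>Serves to bound \<open>card (X \<inter> C)\<close> by the number of ranks available in
  \<open>X\<close>.\<close>

lemma inj_on_P_rank:
  assumes C: "C \<in> Chains (P_poset j)"
    and top: "\<And>x y. x \<in> X \<Longrightarrow> y \<in> X \<Longrightarrow> x \<in> P_elems j \<Longrightarrow> y \<in> P_elems j \<Longrightarrow> P_le x y \<Longrightarrow> x \<noteq> y \<Longrightarrow>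
      snd y = Q_size (fst y) - 1 \<Longrightarrow> P_rank L x < L"
  shows "inj_on (P_rank L) (X \<inter> C)"
proof (rule inj_onI, rule ccontr)
  have less: "P_rank L x < P_rank L y" if "x \<in> X \<inter> C" "y \<in> X \<inter> C" "P_le x y" "x \<noteq> y" for x y
  proof -
    have "x \<in> P_elems j" "y \<in> P_elems j" using that C unfolding Chains_P_poset_iff by blast+
    then show ?thesis using that by (intro P_rank_strict_mono[of x j y L] top[of x y]) simp_all
  qed
  fix x y assume xy: "x \<in> X \<inter> C" "y \<in> X \<inter> C" "P_rank L x = P_rank L y" "x \<noteq> y"
  then have "P_le x y \<or> P_le y x" using C unfolding Chains_P_poset_iff by blast
  then show False using less[of x y] less[of y x] xy by fastforce
qed

text \<open>For \<open>L = j + 1\<close> the maximal \<open>r_i\<close> outrank everything else and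
  only \<open>j + 2\<close> ranks occur; \<open>long_chain j\<close> attains this number.\<close>

lemma height_P_poset:
  assumes "1 \<le> j"
  shows "height (P_poset j) = j + 2"
proof (rule antisym)
  have fin: "finite (Field (P_poset j))" by (simp add: Field_P_poset finite_P_elems)
  obtain C where C: "C \<in> Chains (P_poset j)" "card C = height (P_poset j)"
    using obtain_chain_card_height[OF fin] .
  have "inj_on (P_rank (j + 1)) (UNIV \<inter> C)"
    using C(1)
  proof (rule inj_on_P_rank)
    show "P_rank (j + 1) x < j + 1" if "x \<in> P_elems j" "y \<in> P_elems j" "P_le x y" "x \<noteq> y" for x y
      using that by (cases x; cases y)
        (auto simp: P_rank_def P_elems_def P_le_def Q_size_def split: if_splits)
  qed
  moreover have "P_rank (j + 1) ` C \<subseteq> {..<j + 2}"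
    using C(1) unfolding Chains_P_poset_iff
    by (fastforce simp: P_rank_def P_elems_def Q_size_def split: if_splits)
  ultimately have "card C \<le> card {..<j + 2}"
    by (intro card_inj_on_le) auto
  then show "height (P_poset j) \<le> j + 2" using C(2) by simp
  show "j + 2 \<le> height (P_poset j)"
    using card_le_height[OF fin] long_chain[OF assms order.refl] by metis
qed

text \<open>The number of elements of \<open>Q\<^sub>i\<close> in a largest union of \<open>k\<close> antichains.\<close>

definition row_budget :: "nat \<Rightarrow> nat \<Rightarrow> nat" where
  "row_budget k i = (if i + 1 < k then Q_size i else if i + 1 = k then Q_size i - 1 else k)"

section \<open>Antichain unions and chain partitions of \<open>P_poset j\<close>\<close>

lemma max_antichain_union_P_poset_le:
  assumes k: "1 \<le> k" "k \<le> j + 1"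
  shows "max_antichain_union k (P_poset j) \<le> (\<Sum>i=1..j. row_budget k i)"
proof -
  have fin: "finite (Field (P_poset j))" by (simp add: Field_P_poset finite_P_elems)
  obtain F where F: "\<And>i. i < k \<Longrightarrow> F i \<in> Antichains (P_poset j)"
    and card: "card (\<Union>i<k. F i) = max_antichain_union k (P_poset j)"
    using obtain_max_antichain_union[OF fin] by metis
  let ?U = "\<Union>i<k. F i"
  have chain: "card (?U \<inter> C) \<le> k" if "C \<in> Chains (P_poset j)" for C
    using card_antichain_union_Int_chain_le[of k F] F that by blast
  have U: "?U \<subseteq> P_elems j" using F by (auto simp: Antichains_def Field_P_poset)
  let ?row = "\<lambda>i. {i} \<times> {..<Q_size i}"
  have low: "card (?U \<inter> P_elems (k - 1)) \<le> (\<Sum>i=1..k-1. row_budget k i)"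
  proof (cases "k = 1")
    case False
    then obtain m where m: "k = Suc m" "1 \<le> m" "m \<le> j" using k by (cases k) auto
    \<comment> \<open>The long chain through \<open>P\<^sub>m\<close> has \<open>k + 1\<close> elements, so one of them is missed.\<close>
    have "\<not> long_chain m \<subseteq> ?U"
      using chain[OF long_chain(1)[OF m(2,3)]] long_chain(2)[OF m(2,3)] m(1)
      by (auto simp: Int_absorb1)
    then obtain z where z: "z \<in> P_elems m" "z \<notin> ?U" using long_chain(3)[OF m(2,3)] by blast
    have "card (?U \<inter> P_elems m) \<le> card (P_elems m - {z})"
      using z by (intro card_mono) (auto simp: finite_P_elems)
    also have "\<dots> = (\<Sum>i=1..m. Q_size i) - 1"
      using z by (simp add: P_elems_def card_Diff_singleton_if)
    \<comment> \<open>Whatever row the missed element \<open>z\<close> lies in, the loss is booked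
      in row \<open>k - 1\<close>.\<close>
    also have "\<dots> = (\<Sum>i=1..m. row_budget k i)"
    proof -
      obtain n where n: "m = Suc n" using m(2) by (cases m) auto
      have "(\<Sum>i=1..n. row_budget k i) = (\<Sum>i=1..n. Q_size i)"
        using m(1) n by (intro sum.cong) (auto simp: row_budget_def)
      then show ?thesis using m(1) n by (simp add: row_budget_def Q_size_def)
    qed
    finally show ?thesis using m(1) by simp
  qed (simp add: P_elems_def)
  have high: "card (\<Union>i\<in>{k..j}. ?U \<inter> ?row i) \<le> (\<Sum>i=k..j. row_budget k i)"
  proof -
    have "card (\<Union>i\<in>{k..j}. ?U \<inter> ?row i) \<le> (\<Sum>i=k..j. card (?U \<inter> ?row i))"
      by (rule card_UN_le) simp
    also have "\<dots> \<le> (\<Sum>i=k..j. row_budget k i)"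
    proof (rule sum_mono)
      fix i assume i: "i \<in> {k..j}"
      then have "?row i \<in> Chains (P_poset j)"
        using k unfolding Chains_P_poset_iff by (auto simp: P_elems_def P_le_def)
      from chain[OF this] show "card (?U \<inter> ?row i) \<le> row_budget k i"
        using i by (simp add: row_budget_def)
    qed
    finally show ?thesis .
  qed
  have "?U = (?U \<inter> P_elems (k - 1)) \<union> (\<Union>i\<in>{k..j}. ?U \<inter> ?row i)"
  proof (rule antisym)
    show "?U \<subseteq> (?U \<inter> P_elems (k - 1)) \<union> (\<Union>i\<in>{k..j}. ?U \<inter> ?row i)"
    proof
      fix x assume x: "x \<in> ?U"
      then have "x \<in> P_elems j" using U by blast
      then have "x \<in> P_elems (k - 1) \<or> x \<in> (\<Union>i\<in>{k..j}. ?row i)"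
        using k by (cases x) (auto simp: P_elems_def)
      then show "x \<in> (?U \<inter> P_elems (k - 1)) \<union> (\<Union>i\<in>{k..j}. ?U \<inter> ?row i)" using x by blast
    qed
  qed blast
  then have "card ?U = card ((?U \<inter> P_elems (k - 1)) \<union> (\<Union>i\<in>{k..j}. ?U \<inter> ?row i))"
    by (rule arg_cong)
  also have "\<dots> \<le> card (?U \<inter> P_elems (k - 1)) + card (\<Union>i\<in>{k..j}. ?U \<inter> ?row i)"
    by (rule card_Un_le)
  also have "\<dots> \<le> (\<Sum>i=1..k-1. row_budget k i) + (\<Sum>i=k..j. row_budget k i)"
    by (rule add_mono[OF low high])
  also have "\<dots> = (\<Sum>i=1..j. row_budget k i)"
    using k sum.ub_add_nat[of 1 "k - 1" "row_budget k" "j - (k - 1)"] by simp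
  finally show ?thesis using card by simp
qed


text \<open>A weight argument: give each element of \<open>P\<^sub>j\<close> the weight \<open>[x \<in> A] + [x \<in> B]\<close>, where \<open>A\<close> is a
  maximum union of \<open>k\<close> antichains, and \<open>B\<close> is a maximum union of \<open>l\<close> antichains together with one
  more element. The chains of \<open>l + 1\<close> elements in \<open>B\<close> contain \<open>u, s\<^sub>1, \<dots>, s\<^bsub>l-1\<^esub>\<close>; since
  \<open>l \<ge> k + 2\<close>, the set \<open>A\<close> can be chosen to meet each of them in fewer than \<open>k\<close> elements.\<close>

lemma P_poset_truncated_size_gap:
  assumes k: "1 \<le> k" and l: "k + 2 \<le> l" "l \<le> j + 1"
    and part: "chain_partition (P_poset j) \<C>"
  shows "max_antichain_union k (P_poset j) + max_antichain_union l (P_poset j)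
    < truncated_size k \<C> + truncated_size l \<C>"
proof -
  \<comment> \<open>The rows of \<open>A\<close> and \<open>B\<close>. With
    \<open>L = k - 1\<close>, the elements of \<open>A\<close> of rank \<open>k - 1\<close> are the
    \<open>r_i\<close> with \<open>i \<le> l - 2\<close> and the \<open>(i, k - 1)\<close> with
    \<open>i \<ge> l - 1\<close>, which lie in \<open>T_i\<close>.\<close>
  define RA where "RA i = (if l \<le> i + 1 then {..<k} else if i + 1 < k then {..<Q_size i}
    else if i + 1 = k then {..<Q_size i} - {Q_size i - 2} else {..<k - 1} \<union> {Q_size i - 1})" for i
  define RB where "RB i = (if i < l then {..<Q_size i} else {..<l - 1} \<union> {Q_size i - 1})" for i
  define A B where "A = (SIGMA i:{1..j}. RA i)" and "B = (SIGMA i:{1..j}. RB i)"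
  have cardRA: "card (RA i) = row_budget k i" if "i \<in> {1..j}" for i
    using that k l by (auto simp: RA_def row_budget_def Q_size_def card_Diff_singleton_if)
  \<comment> \<open>Row \<open>l - 1\<close> is complete in \<open>B\<close>, while
    \<open>row_budget l\<close> leaves out one element there: this is the extra element that makes
    the final inequality strict.\<close>
  have cardRB: "card (RB i) = row_budget l i + of_bool (i = l - 1)" if "i \<in> {1..j}" for i
    using that k l by (auto simp: RB_def row_budget_def Q_size_def)
  have finR: "finite (RA i)" "finite (RB i)" for i by (auto simp: RA_def RB_def)
  have cardA: "card A = (\<Sum>i=1..j. row_budget k i)"
    using finR by (simp add: A_def cardRA)
  have "l - 1 \<in> {1..j}" using k l by auto
  then have "(\<Sum>i=1..j. of_bool (i = l - 1)) = (1::nat)"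
    by (simp add: of_bool_def sum.delta del: atLeastAtMost_iff)
  then have cardB: "card B = (\<Sum>i=1..j. row_budget l i) + 1"
    using finR by (simp add: B_def cardRB sum.distrib)
  have sub: "A \<subseteq> P_elems j" "B \<subseteq> P_elems j"
    using k l by (auto simp: A_def B_def RA_def RB_def P_elems_def Q_size_def split: if_splits)
  have rankA: "P_rank (k - 1) x < k" if "x \<in> A" for x
    using that k l
    by (cases x) (auto simp: A_def RA_def P_rank_def Q_size_def split: if_splits)
  have rankB: "P_rank l x \<le> l" if "x \<in> B" for x
    using that k l
    by (cases x) (auto simp: B_def RB_def P_rank_def Q_size_def split: if_splits)
  have topA: "fst x \<le> l - 2" if "x \<in> A" "snd x = Q_size (fst x) - 1" for x
    using that k l by (cases x) (auto simp: A_def RA_def Q_size_def split: if_splits)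
  have lowA: "P_rank (k - 1) x < k - 1"
    if "x \<in> A" "snd x \<noteq> Q_size (fst x) - 1" "fst x \<le> l - 2" for x
    using that k l by (cases x) (auto simp: A_def RA_def P_rank_def Q_size_def split: if_splits)
  have lowB: "P_rank l x < l" if "x \<in> B" "snd x \<noteq> Q_size (fst x) - 1" for x
    using that k l by (cases x) (auto simp: B_def RB_def P_rank_def Q_size_def split: if_splits)
  have chain_bound: "card (A \<inter> C) + card (B \<inter> C) \<le> min k (card C) + min l (card C)"
    if C: "C \<in> Chains (P_poset j)" for C
  proof -
    have finC: "finite C" using C finite_P_elems finite_subset unfolding Chains_P_poset_iff by blast
    have injA: "inj_on (P_rank (k - 1)) (A \<inter> C)"
      using C
    proof (rule inj_on_P_rank)
      show "P_rank (k - 1) x < k - 1" if "x \<in> A" "y \<in> A" "P_le x y" "x \<noteq> y"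
        "snd y = Q_size (fst y) - 1" for x y
      proof (rule lowA[OF that(1)])
        show "snd x \<noteq> Q_size (fst x) - 1"
          using P_le_not_top[OF _ that(3,4), of j] sub that(1,2) by blast
        show "fst x \<le> l - 2"
          using topA[OF that(2,5)] that(3) by (auto simp: P_le_def)
      qed
    qed
    have injB: "inj_on (P_rank l) (B \<inter> C)"
      using C
    proof (rule inj_on_P_rank)
      show "P_rank l x < l" if "x \<in> B" "y \<in> B" "P_le x y" "x \<noteq> y"
        "snd y = Q_size (fst y) - 1" for x y
        using lowB[OF that(1)] P_le_not_top[OF _ that(3,4), of j] sub that(1,2) by blast
    qed
    have imA: "P_rank (k - 1) ` (A \<inter> C) \<subseteq> {..<k}" using rankA by auto
    have imB: "P_rank l ` (B \<inter> C) \<subseteq> {..l}" using rankB by auto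
    have A_le: "card (A \<inter> C) \<le> k"
      using card_inj_on_le[OF injA imA] by simp
    have B_le: "card (B \<inter> C) \<le> l + 1"
      using card_inj_on_le[OF injB imB] by simp
    \<comment> \<open>Otherwise all ranks occur, so \<open>C\<close> contains some \<open>p\<close>
      in \<open>A\<close> of rank \<open>k - 1\<close> and some \<open>q\<close>, \<open>q'\<close>
      in \<open>B\<close> of ranks \<open>l - 1\<close>, \<open>l - 2\<close>. The latter turn out
      to be \<open>s_(l-1)\<close> and \<open>s_(l-2)\<close>, and no such \<open>p\<close> is
      comparable to both.\<close>
    have "\<not> (card (A \<inter> C) = k \<and> card (B \<inter> C) = l + 1)"
    proof
      assume eq: "card (A \<inter> C) = k \<and> card (B \<inter> C) = l + 1"
      have "P_rank (k - 1) ` (A \<inter> C) = {..<k}"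
        using conjunct1[OF eq] imA by (intro card_subset_eq)
          (simp_all only: finite_lessThan card_image[OF injA] card_lessThan)
      then have "k - 1 \<in> P_rank (k - 1) ` (A \<inter> C)" using k by auto
      then obtain p where p: "p \<in> A" "p \<in> C" "P_rank (k - 1) p = k - 1" by force
      have imB': "P_rank l ` (B \<inter> C) = {..l}"
        using conjunct2[OF eq] imB by (intro card_subset_eq) (simp_all add: card_image[OF injB])
      then have "l - 1 \<in> P_rank l ` (B \<inter> C)" by auto
      then obtain q where q: "q \<in> B" "q \<in> C" "P_rank l q = l - 1" by force
      from imB' have "l - 2 \<in> P_rank l ` (B \<inter> C)" by auto
      then obtain q' where q': "q' \<in> B" "q' \<in> C" "P_rank l q' = l - 2" by force
      have comp: "P_le x y \<or> P_le y x" if "x \<in> C" "y \<in> C" for x y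
        using that C unfolding Chains_P_poset_iff by blast
      have q_eq: "q = (l - 1, l - 2)"
        using q(1,3) k l
        by (cases q) (auto simp: B_def RB_def P_rank_def Q_size_def split: if_splits)
      have "q' = (l - 2, Q_size (l - 2) - 2) \<or> fst q' \<ge> l \<and> snd q' = l - 2"
        using q'(1,3) k l
        by (cases q') (auto simp: B_def RB_def P_rank_def Q_size_def split: if_splits)
      then have q'_eq: "q' = (l - 2, Q_size (l - 2) - 2)"
        using comp[OF q(2) q'(2)] k l unfolding q_eq
        by (cases q') (auto simp: P_le_def Q_size_def split: if_splits)
      show False
      proof (cases "fst p \<le> l - 2")
        case True
        then have "snd p = Q_size (fst p) - 1" using lowA[OF p(1)] p(3) by linarith
        moreover have "1 \<le> fst p" using p(1) by (auto simp: A_def)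
        ultimately show False
          using True comp[OF q(2) p(2)] k l unfolding q_eq
          by (auto simp: P_le_def Q_size_def split: if_splits)
      next
        case False
        then have "l \<le> fst p + 1" using l by linarith
        then have "snd p < k" using p(1) by (cases p) (auto simp: A_def RA_def)
        obtain m where m: "l = m + 2" "k \<le> m" 
          using l by (intro that[of "l - 2"]) simp_all
        have size: "Q_size (fst p) = fst p + 1" using False m k by (simp add: Q_size_def)
        consider "m + 2 \<le> fst p" | "fst p = m + 1" using False m by linarith
        then show False
        proof cases
          case 1
          then have "\<not> P_le q p" "\<not> P_le p q"
            using \<open>snd p < k\<close> m(2) by (auto simp: P_le_def q_eq m(1) size)
          then show False using comp[OF q(2) p(2)] by blast
        next
          case 2
          \<comment> \<open>Here \<open>p\<close> and \<open>q\<close> share a chain, so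
            \<open>q'\<close> is what conflicts: by \<open>k + 2 \<le> l\<close>, \<open>p\<close>
            lies in \<open>T_(l-1)\<close>, out of reach from \<open>s_(l-2)\<close>.\<close>
          then have "\<not> P_le q' p" "\<not> P_le p q'"
            using \<open>snd p < k\<close> m(2) size by (simp_all add: P_le_def q'_eq m(1))
          then show False using comp[OF q'(2) p(2)] by blast
        qed
      qed
    qed
    then have "card (A \<inter> C) + card (B \<inter> C) \<le> k + l" using A_le B_le by linarith
    moreover have "card (A \<inter> C) \<le> card C" "card (B \<inter> C) \<le> card C"
      using finC by (auto intro: card_mono)
    \<comment> \<open>For \<open>card C < l\<close> the trivial bounds and \<open>A_le\<close>
      suffice; otherwise the right-hand side is \<open>k + l\<close>.\<close>
    ultimately show ?thesis using A_le l by (auto simp: min_def)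
  qed
  have fin: "finite (Field (P_poset j))" by (simp add: Field_P_poset finite_P_elems)
  have P: "partition_on (Field (P_poset j)) \<C>" and ch: "\<C> \<subseteq> Chains (P_poset j)"
    using part by (auto simp: chain_partition_def)
  have "card A + card B = (\<Sum>C\<in>\<C>. card (A \<inter> C) + card (B \<inter> C))"
    using sub card_eq_sum_partition[OF fin P] by (simp add: sum.distrib Field_P_poset)
  also have "\<dots> \<le> (\<Sum>C\<in>\<C>. min k (card C) + min l (card C))"
    using ch by (intro sum_mono chain_bound) auto
  also have "\<dots> = truncated_size k \<C> + truncated_size l \<C>"
    by (simp add: truncated_size_def sum.distrib)
  finally show ?thesis
    using max_antichain_union_P_poset_le[of k j] max_antichain_union_P_poset_le[of l j]
      cardA cardB k l by simp
qed

section \<open>Polyunsaturation and width of \<open>P_poset j\<close>\<close>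

lemma polyunsaturated_P_poset:
  assumes "1 \<le> j"
  shows "polyunsaturated (P_poset j)"
proof -
  have no: False
    if "1 \<le> k" "k + 2 \<le> l" "l < height (P_poset j)" "chain_partition (P_poset j) \<C>"
      "saturated k (P_poset j) \<C>" "saturated l (P_poset j) \<C>" for k l \<C>
    using P_poset_truncated_size_gap[of k l j \<C>] that height_P_poset[OF assms]
    by (simp add: saturated_def)
  show ?thesis
    unfolding polyunsaturated_def
  proof (intro conjI notI finite_poset_P_poset, elim exE conjE)
    fix k l \<C>
    assume kl: "0 < k" "k < height (P_poset j)" "0 < l" "l < height (P_poset j)"
      "k \<noteq> l" "k \<noteq> Suc l" "l \<noteq> Suc k"
      and C: "chain_partition (P_poset j) \<C>" "saturated k (P_poset j) \<C>" "saturated l (P_poset j) \<C>"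
    consider "k + 2 \<le> l" | "l + 2 \<le> k" using kl(5-7) by linarith
    then show False
    proof cases
      case 1
      then show False using kl(1) by (intro no[OF _ _ kl(4) C]) simp_all
    next
      case 2
      then show False using kl(3) by (intro no[OF _ _ kl(2) C(1,3,2)]) simp_all
    qed
  qed
qed

lemma width_P_poset_le: "width (P_poset j) \<le> j"
proof -
  have "width (P_poset j) = max_antichain_union 1 (P_poset j)"
    using max_antichain_union_one[of "P_poset j"] by (simp add: Field_P_poset finite_P_elems)
  also have "\<dots> \<le> (\<Sum>i=1..j. row_budget 1 i)"
    by (rule max_antichain_union_P_poset_le) auto
  also have "\<dots> = j" by (simp add: row_budget_def)
  finally show ?thesis .
qed

theorem mainTheorem7:
  fixes j :: nat
  assumes "1 \<le> j"
  shows "polyunsaturated (P_poset j) \<and>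
    (\<forall>r :: 'a rel. polyunsaturated r \<and> height r = height (P_poset j) \<longrightarrow>
       width (P_poset j) \<le> width r \<and> card (Field (P_poset j)) \<le> card (Field r))"
proof (intro conjI allI impI; (elim conjE)?)
  show "polyunsaturated (P_poset j)" using assms by (rule polyunsaturated_P_poset)
  fix r :: "'a rel"
  assume poly: "polyunsaturated r" and "height r = height (P_poset j)"
  then have "height r = j + 2" using height_P_poset[OF assms] by simp
  note bounds = polyunsaturated_lower_bounds[OF poly this assms]
  show "width (P_poset j) \<le> width r"
    using bounds(1) width_P_poset_le[of j] by simp
  show "card (Field (P_poset j)) \<le> card (Field r)"
    using bounds(2) card_P_elems[of j] assms by (simp add: Field_P_poset)
qed

end
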